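(* Let $F:\mathbb{R}^n\to\mathbb{R}$ be a generic, PL Morse ReLU neural network of architecture $(n,n+1,1)$ whose only flat cells are vertices. Then the decision boundary $F^{-1}(0)$ of $F$ is empty, or has the homotopy type of a point, or has the homotopy type of an $(n-1)$-sphere.
   Context: A ReLU neural network of architecture $(n,n+1,1)$ is a function $F=G\circ\mathrm{ReLU}\circ A_1:\mathbb{R}^n\to\mathbb{R}$ with $A_1:\mathbb{R}^n\to\mathbb{R}^{n+1}$ and $G:\mathbb{R}^{n+1}\to\mathbb{R}$ affine, $\mathrm{ReLU}$ being $x\mapsto\max\{0,x\}$ coordinatewise. Let $H_j=\{x\in\mathbb{R}^n:\pi_jA_1(x)=0\}$, $1\le j\le n+1$. $F$ is generic if the hyperplanes $H_j$ are in general position (any $r$ of them meet in codimension $r$, or in the empty set if $r>n$). The canonical polyhedral complex $\mathcal{C}(F)$ is the polyhedral decomposition of $\mathbb{R}^n$ by the arrangement $\{H_j\}$; $F$ is affine on its cells. A cell is flat if $F$ is constant on it. The $\nabla F$-orientation orients each edge on which $F$ is nonconstant in the direction of increase of $F$. At each vertex $v$ exactly $n$ of the hyperplanes meet, and the $2n$ incident edges come in $n$ opposite pairs $e_i^+,e_i^-$ (lying on opposite sides of one of these hyperplanes, and contained in the other $n-1$). A vertex $v$ is PL critical of index $k$ if for every $i$ the edges $e_i^+,e_i^-$ are both oriented toward $v$ or both oriented away from $v$, with exactly $k$ pairs oriented toward $v$; it is PL regular if some pair has one edge oriented toward $v$ and the other away from $v$. (For networks whose only flat cells are vertices this is equivalent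 to the general definition of PL critical/regular points.) $F$ is PL Morse if every vertex is PL regular or PL critical of some index $0\le k\le n$; this holds if and only if every edge has a $\nabla F$-orientation. *)

theory Defs
  imports "HOL-Analysis.Analysis"
begin

definition affine_map :: "('a::real_vector \<Rightarrow> 'b::real_vector) \<Rightarrow> bool"
  where "affine_map f \<longleftrightarrow> (\<exists>L b. linear L \<and> f = (\<lambda>x. L x + b))"

definition relu :: "real^'m \<Rightarrow> real^'m"
  where "relu x = (\<chi> j. max 0 (x $ j))"

text \<open>
  Throughout, \<open>A\<close> is the first layer map. Its hyperplane arrangement and the resulting
  complex depend only on \<open>A\<close>; the orientation of the edges depends on the network function \<open>F\<close>.
\<close>

definition hyperplane :: "(real^'n \<Rightarrow> real^'m) \<Rightarrow> 'm \<Rightarrow> (real^'n) set"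
  where "hyperplane A j = {x. A x $ j = 0}"

text \<open>
  For singleton \<open>J\<close>, genericity says that each \<open>hyperplane A j\<close> is a genuine hyperplane,
  i.e. neither empty nor the whole space.
\<close>

definition generic :: "(real^'n \<Rightarrow> real^'m) \<Rightarrow> bool"
  where "generic A \<longleftrightarrow>
    (\<forall>J. J \<noteq> {} \<longrightarrow>
      (card J \<le> CARD('n) \<longrightarrow>
        aff_dim (\<Inter>j\<in>J. hyperplane A j) = int CARD('n) - int (card J)) \<and>
      (card J > CARD('n) \<longrightarrow> (\<Inter>j\<in>J. hyperplane A j) = {}))"

text \<open>
  The cells are closed: a cell is a nonempty set obtained by choosing, for every index \<open>j\<close>,
  the hyperplane or one of its two closed half-spaces, and intersecting these choices.
\<close>

definition canonical_complex :: "(real^'n \<Rightarrow> real^'m) \<Rightarrow> (real^'n) set set"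
  where "canonical_complex A =
    {C. C \<noteq> {} \<and>
        (\<exists>S. (\<forall>j. S j \<in> {hyperplane A j, {x. A x $ j \<ge> 0}, {x. A x $ j \<le> 0}}) \<and>
             C = (\<Inter>j. S j))}"

definition vertices :: "(real^'n \<Rightarrow> real^'m) \<Rightarrow> (real^'n) set"
  where "vertices A = {v. {v} \<in> canonical_complex A}"

definition edges :: "(real^'n \<Rightarrow> real^'m) \<Rightarrow> (real^'n) set set"
  where "edges A = {e \<in> canonical_complex A. aff_dim e = 1}"

definition flat_cell :: "(real^'n \<Rightarrow> real^'m) \<Rightarrow> (real^'n \<Rightarrow> real) \<Rightarrow> (real^'n) set \<Rightarrow> bool"
  where "flat_cell A F C \<longleftrightarrow> C \<in> canonical_complex A \<and> F constant_on C"

text \<open>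
  The orientation of an edge \<open>e\<close> at an endpoint \<open>v\<close> of it. The network function is affine on
  \<open>e\<close>, so its direction of increase points to \<open>v\<close> iff \<open>F\<close> attains its strict maximum over \<open>e\<close>
  at \<open>v\<close>. If \<open>F\<close> is constant on \<open>e\<close>, neither predicate holds.
\<close>

definition oriented_toward :: "(real^'n \<Rightarrow> real) \<Rightarrow> (real^'n) set \<Rightarrow> real^'n \<Rightarrow> bool"
  where "oriented_toward F e v \<longleftrightarrow> v \<in> e \<and> (\<forall>x\<in>e - {v}. F x < F v)"

definition oriented_away :: "(real^'n \<Rightarrow> real) \<Rightarrow> (real^'n) set \<Rightarrow> real^'n \<Rightarrow> bool"
  where "oriented_away F e v \<longleftrightarrow> v \<in> e \<and> (\<forall>x\<in>e - {v}. F v < F x)"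

text \<open>
  \<open>p\<close> and \<open>q\<close> are the two edges at \<open>v\<close> that lie on opposite sides of the hyperplane \<open>i\<close> through
  \<open>v\<close> and in all the other hyperplanes through \<open>v\<close>. For generic \<open>A\<close> this labels the opposite
  pairs of edges at \<open>v\<close> by the hyperplanes through \<open>v\<close>.
\<close>

definition opposite_edges ::
    "(real^'n \<Rightarrow> real^'m) \<Rightarrow> real^'n \<Rightarrow> 'm \<Rightarrow> (real^'n) set \<Rightarrow> (real^'n) set \<Rightarrow> bool"
  where "opposite_edges A v i p q \<longleftrightarrow>
    v \<in> hyperplane A i \<and>
    p \<in> edges A \<and> q \<in> edges A \<and> v \<in> p \<and> v \<in> q \<and>
    (\<forall>x\<in>p - {v}. A x $ i > 0) \<and> (\<forall>x\<in>q - {v}. A x $ i < 0) \<and>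
    (\<forall>j. j \<noteq> i \<and> v \<in> hyperplane A j \<longrightarrow> p \<subseteq> hyperplane A j \<and> q \<subseteq> hyperplane A j)"

definition PL_critical :: "(real^'n \<Rightarrow> real^'m) \<Rightarrow> (real^'n \<Rightarrow> real) \<Rightarrow> real^'n \<Rightarrow> nat \<Rightarrow> bool"
  where "PL_critical A F v k \<longleftrightarrow>
    (\<forall>i p q. opposite_edges A v i p q \<longrightarrow>
      oriented_toward F p v \<and> oriented_toward F q v \<or>
      oriented_away F p v \<and> oriented_away F q v) \<and>
    card {i. \<exists>p q. opposite_edges A v i p q \<and>
                   oriented_toward F p v \<and> oriented_toward F q v} = k"

definition PL_regular :: "(real^'n \<Rightarrow> real^'m) \<Rightarrow> (real^'n \<Rightarrow> real) \<Rightarrow> real^'n \<Rightarrow> bool"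
  where "PL_regular A F v \<longleftrightarrow>
    (\<exists>i p q. opposite_edges A v i p q \<and>
      (oriented_toward F p v \<and> oriented_away F q v \<or>
       oriented_away F p v \<and> oriented_toward F q v))"

definition PL_Morse :: "(real^'n \<Rightarrow> real^'m) \<Rightarrow> (real^'n \<Rightarrow> real) \<Rightarrow> bool"
  where "PL_Morse A F \<longleftrightarrow>
    (\<forall>v\<in>vertices A. PL_regular A F v \<or> (\<exists>k\<le>CARD('n). PL_critical A F v k))"

end

theory Submission
  imports Defs
begin

text \<open>
  The \<open>n + 1\<close> hyperplanes bound a simplex with vertices \<open>v j\<close> (where \<open>v j\<close> lies on all hyperplanes
  but the \<open>j\<close>-th), and the barycentric coordinates of \<open>x\<close> are \<open>A x $ j / A (v j) $ j\<close>.
  Since no edge is flat, looking at the edges on the line through \<open>v k\<close> and \<open>v l\<close> shows that all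
  \<open>A (v j) $ j\<close> are positive and that in \<open>F x = c + (\<Sum>j. g j * max 0 (A x $ j))\<close> all \<open>g j\<close> are
  nonzero. If all \<open>g j\<close> have the same sign, \<open>F\<close> or \<open>- F\<close> is convex with compact sublevel sets, so the
  level set is empty, convex, or the frontier of a convex body. If both signs occur, \<open>F\<close> increases
  from \<open>-\<infinity>\<close> to \<open>\<infinity>\<close> along every line in a suitable fixed direction, so the level set is a graph
  over a hyperplane and hence contractible.
\<close>

section \<open>Level sets\<close>

text \<open>Each line in direction \<open>d\<close> crosses the level set exactly once, so sliding
  every point along \<open>d\<close> to its crossing retracts the whole space onto the level
  set.\<close>

lemma contractible_level_set_of_increasing:
  fixes F :: "'a::real_normed_vector \<Rightarrow> real"
  assumes cont: "continuous_on UNIV F"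
    and mono: "\<And>x. strict_mono (\<lambda>s. F (x + s *\<^sub>R d))"
    and root: "\<And>x. \<exists>s. F (x + s *\<^sub>R d) = 0"
  shows "F -` {0} \<noteq> {}" and "contractible (F -` {0})"
proof -
  show "F -` {0} \<noteq> {}" using root by auto
  obtain s where s: "F (x + s x *\<^sub>R d) = 0" for x
    using root by metis
  have less: "F (x + t *\<^sub>R d) < 0 \<longleftrightarrow> t < s x" for x t
    using strict_mono_less[OF mono, of x t "s x"] s[of x] by simp
  have greater: "F (x + t *\<^sub>R d) > 0 \<longleftrightarrow> t > s x" for x t
    using strict_mono_less[OF mono, of x "s x" t] s[of x] by simp
  have contF: "continuous_on UNIV (\<lambda>x. F (x + t *\<^sub>R d))" for t
    by (rule continuous_on_compose2[OF cont]) (auto intro!: continuous_intros)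
  \<comment> \<open>By \<open>less\<close> and \<open>greater\<close>, both \<open>a < s x\<close>
    and \<open>s x < a\<close> are strict inequalities for the continuous function \<open>F\<close>
    at \<open>x + a *\<^sub>R d\<close>, hence open conditions on \<open>x\<close>.\<close>
  have "isCont s x" for x
    unfolding isCont_def
  proof (rule order_tendstoI)
    fix a assume "a < s x"
    moreover have "open {x. F (x + a *\<^sub>R d) < 0}"
      by (intro open_Collect_less contF continuous_intros)
    ultimately have "\<forall>\<^sub>F y in nhds x. F (y + a *\<^sub>R d) < 0"
      using less by (auto simp: eventually_nhds)
    then show "\<forall>\<^sub>F y in at x. a < s y"
      by (simp add: less eventually_at_filter eventually_mono)
  next
    fix a assume "s x < a"
    moreover have "open {x. F (x + a *\<^sub>R d) > 0}"
      by (intro open_Collect_less contF continuous_intros)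
    ultimately have "\<forall>\<^sub>F y in nhds x. F (y + a *\<^sub>R d) > 0"
      using greater by (auto simp: eventually_nhds)
    then show "\<forall>\<^sub>F y in at x. s y < a"
      by (simp add: greater eventually_at_filter eventually_mono)
  qed
  then have conts: "continuous_on UNIV s"
    by (simp add: continuous_at_imp_continuous_on)
  have fixed: "s x = 0" if "F x = 0" for x
  proof -
    have "\<not> 0 < s x" "\<not> s x < 0"
      using that less[of x 0] greater[of x 0] by auto
    then show ?thesis by simp
  qed
  have "retraction UNIV (F -` {0}) (\<lambda>x. x + s x *\<^sub>R d)"
    unfolding retraction_def
    by (auto intro!: continuous_intros conts simp: s fixed)
  then have "F -` {0} retract_of UNIV"
    unfolding retract_of_def by blast
  then show "contractible (F -` {0})"
    using contractible_UNIV retract_of_contractible by blast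
qed

text \<open>From an interior point one can move slightly beyond \<open>x\<close>, away from
  \<open>z\<close>, and stay in the sublevel set. Then \<open>x\<close> is a convex combination of
  \<open>z\<close> and the new point with positive weight on \<open>z\<close>, where
  \<open>F\<close> is negative.\<close>

lemma interior_sublevel_set_less:
  fixes F :: "'a::real_normed_vector \<Rightarrow> real"
  assumes conv: "convex_on UNIV F" and z: "F z < 0" and x: "x \<in> interior {x. F x \<le> 0}"
  shows "F x < 0"
proof (cases "x = z")
  case False
  obtain e where e: "e > 0" "ball x e \<subseteq> {x. F x \<le> 0}"
    using x mem_interior by blast
  \<comment> \<open>This choice puts \<open>y\<close> at distance \<open>e / 2\<close> from
    \<open>x\<close>.\<close>
  define t where "t = e / (2 * norm (x - z))"
  have t: "t > 0" using e False by (simp add: t_def)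
  define y where "y = x + t *\<^sub>R (x - z)"
  have "dist x y < e"
    using e False by (simp add: y_def dist_norm t_def)
  then have "F y \<le> 0" using e by auto
  have "(t / (1 + t)) *\<^sub>R z + (1 / (1 + t)) *\<^sub>R y
      = (1 / (1 + t)) *\<^sub>R (t *\<^sub>R z + (x + t *\<^sub>R (x - z)))"
    by (simp add: y_def scaleR_add_right)
  also have "\<dots> = (1 / (1 + t)) *\<^sub>R ((1 + t) *\<^sub>R x)"
    by (simp add: algebra_simps)
  also have "\<dots> = x" using t by simp
  finally have x_eq: "(t / (1 + t)) *\<^sub>R z + (1 / (1 + t)) *\<^sub>R y = x" .
  have sum1: "t / (1 + t) + 1 / (1 + t) = 1"
    using t by (simp add: add_divide_distrib[symmetric] add.commute)
  have "F ((t / (1 + t)) *\<^sub>R z + (1 / (1 + t)) *\<^sub>R y) \<le> t / (1 + t) * F z + 1 / (1 + t) * F y"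
    using conv sum1 t unfolding convex_on_def
    by (meson UNIV_I divide_nonneg_pos add_pos_pos less_imp_le zero_less_one)
  then have "F x \<le> t / (1 + t) * F z + 1 / (1 + t) * F y"
    unfolding x_eq .
  moreover have "t / (1 + t) * F z < 0" using t z by (intro mult_pos_neg) auto
  moreover have "1 / (1 + t) * F y \<le> 0" using t \<open>F y \<le> 0\<close> by (intro mult_nonneg_nonpos) auto
  ultimately show ?thesis by linarith
qed (use z in simp)

text \<open>If \<open>F\<close> is never negative, the level set is the convex set \<open>?K\<close>
  itself. Otherwise \<open>?K\<close> has nonempty interior, on which \<open>F\<close> is negative,
  and the level set is the frontier of a convex body.\<close>

lemma level_set_of_convex:
  fixes F :: "'a::euclidean_space \<Rightarrow> real"
  assumes cont: "continuous_on UNIV F" and conv: "convex_on UNIV F"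
    and bdd: "bounded {x. F x \<le> 0}"
  shows "F -` {0} = {} \<or> F -` {0} homotopy_eqv {0 :: 'a}
    \<or> F -` {0} homotopy_eqv sphere (0 :: 'a) 1"
proof -
  let ?K = "{x. F x \<le> 0}"
  have convK: "convex ?K"
  proof (rule convexI)
    fix x y and u v :: real
    assume *: "x \<in> ?K" "y \<in> ?K" "0 \<le> u" "0 \<le> v" "u + v = 1"
    then have "F (u *\<^sub>R x + v *\<^sub>R y) \<le> u * F x + v * F y"
      using conv unfolding convex_on_def by auto
    moreover have "u * F x \<le> 0" "v * F y \<le> 0"
      using * by (auto intro: mult_nonneg_nonpos)
    ultimately show "u *\<^sub>R x + v *\<^sub>R y \<in> ?K" by simp
  qed
  show ?thesis
  proof (cases "\<exists>z. F z < 0")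
    case False
    then have "F -` {0} = ?K" by (auto simp: not_less order.antisym)
    then have "contractible (F -` {0})" using convK convex_imp_contractible by metis
    then show ?thesis using homotopy_eqv_sing by blast
  next
    case True
    then obtain z where z: "F z < 0" ..
    have "open {x. F x < 0}" by (intro open_Collect_less cont continuous_intros)
    then have "{x. F x < 0} \<subseteq> interior ?K" by (intro interior_maximal) auto
    then have int: "interior ?K = {x. F x < 0}"
      using interior_sublevel_set_less[OF conv z] by blast
    have "closed ?K" by (intro closed_Collect_le cont continuous_intros)
    then have "frontier ?K = F -` {0}" by (auto simp: frontier_def int)
    moreover have ne: "interior ?K \<noteq> {}" using z int by auto
    ultimately have rel: "rel_frontier ?K = F -` {0}"
      by (simp add: rel_frontier_nonempty_interior)
    \<comment> \<open>Both sets are bounded, convex and full-dimensional, and the relative frontier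
      of the unit ball is the unit sphere.\<close>
    have "rel_frontier ?K homeomorphic rel_frontier (cball (0 :: 'a) 1)"
      using ne by (intro homeomorphic_rel_frontiers_convex_bounded_sets convK bdd)
        (auto simp: aff_dim_nonempty_interior aff_dim_cball)
    then show ?thesis
      by (simp add: rel homeomorphic_imp_homotopy_eqv)
  qed
qed

section \<open>Affine maps and barycentric coordinates\<close>

lemma affine_map_sum:
  assumes "affine_map A" and "(\<Sum>j\<in>I. u j) = 1"
  shows "A (\<Sum>j\<in>I. u j *\<^sub>R v j) = (\<Sum>j\<in>I. u j *\<^sub>R A (v j))"
proof -
  obtain L b where L: "linear L" and A: "A = (\<lambda>x. L x + b)"
    using assms(1) unfolding affine_map_def by blast
  show ?thesis
    using assms(2)
    by (simp add: A linear_sum[OF L] linear_scale[OF L] scaleR_add_right sum.distrib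
        flip: scaleR_left.sum)
qed

lemma affine_map_vec_eq:
  fixes G :: "real^'m \<Rightarrow> real"
  assumes "affine_map G"
  obtains c g where "\<And>y. G y = c + (\<Sum>j\<in>UNIV. g j * y $ j)"
proof -
  obtain L b where L: "linear L" and G: "G = (\<lambda>x. L x + b)"
    using assms unfolding affine_map_def by blast
  have "L y = (\<Sum>j\<in>UNIV. L (axis j 1) * y $ j)" for y
  proof -
    have "L y = L (\<Sum>j\<in>UNIV. y $ j *\<^sub>R axis j 1)"
      using basis_expansion[of y] by (simp add: scalar_mult_eq_scaleR)
    then show ?thesis by (simp add: linear_sum[OF L] linear_scale[OF L] mult.commute)
  qed
  moreover have "G y = b + L y" for y by (simp add: G)
  ultimately show ?thesis using that[of b "\<lambda>j. L (axis j 1)"] by metis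
qed

text \<open>Coordinate \<open>k\<close> of \<open>A\<close> vanishes at every \<open>v j\<close>
  except \<open>v k\<close>. Applying \<open>A\<close> to an affine dependence therefore isolates
  each coefficient, so the \<open>n + 1\<close> points are affinely independent and their affine
  hull is the whole space.\<close>

lemma barycentric_coordinates:
  fixes A :: "real^'n \<Rightarrow> real^'m" and v :: "'m \<Rightarrow> real^'n"
  assumes card: "CARD('m) = CARD('n) + 1" and aff: "affine_map A"
    and off: "\<And>j k. j \<noteq> k \<Longrightarrow> A (v k) $ j = 0" and diag: "\<And>k. A (v k) $ k \<noteq> 0"
  obtains u where "sum u UNIV = 1" "x = (\<Sum>j\<in>UNIV. u j *\<^sub>R v j)"
    "\<And>j. A x $ j = u j * A (v j) $ j"
proof -
  obtain L b where L: "linear L" and A: "A = (\<lambda>x. L x + b)"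
    using aff unfolding affine_map_def by blast
  have row: "(\<Sum>j\<in>UNIV. c j * A (v j) $ k) = c k * A (v k) $ k" for c k
  proof -
    have "(\<Sum>j\<in>UNIV. c j * A (v j) $ k) = (\<Sum>j\<in>UNIV. if j = k then c k * A (v k) $ k else 0)"
      using off by (intro sum.cong) auto
    then show ?thesis by simp
  qed
  have inj: "inj v"
    by (rule injI) (metis off diag)
  have "\<not> affine_dependent (range v)"
  proof
    assume "affine_dependent (range v)"
    then obtain U w where U: "sum U (range v) = 0" "w \<in> range v" "U w \<noteq> 0"
        "(\<Sum>w\<in>range v. U w *\<^sub>R w) = 0"
      using affine_dependent_explicit_finite[of "range v"] by auto
    then obtain k where k: "w = v k" by blast
    have s0: "(\<Sum>j\<in>UNIV. U (v j)) = 0" and s1: "(\<Sum>j\<in>UNIV. U (v j) *\<^sub>R v j) = 0"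
      using U by (simp_all add: sum.reindex[OF inj])
    \<comment> \<open>The coefficients sum to zero, so the term in \<open>b\<close> may be added; it
      turns \<open>L\<close> into the affine map \<open>A\<close>.\<close>
    have "0 = L (\<Sum>j\<in>UNIV. U (v j) *\<^sub>R v j) + (\<Sum>j\<in>UNIV. U (v j)) *\<^sub>R b"
      by (simp add: s0 s1 linear_0[OF L])
    also have "\<dots> = (\<Sum>j\<in>UNIV. U (v j) *\<^sub>R A (v j))"
      by (simp add: A linear_sum[OF L] linear_scale[OF L] scaleR_add_right sum.distrib
          scaleR_left.sum)
    finally have "(\<Sum>j\<in>UNIV. U (v j) *\<^sub>R A (v j)) $ k = 0" by simp
    then have "U (v k) * A (v k) $ k = 0" by (simp add: row)
    then show False using U k diag by simp
  qed
  then have "int (card (range v)) = aff_dim (range v) + 1"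
    using aff_dim_affine_independent by blast
  moreover have "card (range v) = CARD('n) + 1" using card inj by (simp add: card_image)
  ultimately have "affine hull (range v) = UNIV"
    by (subst aff_dim_eq_full[symmetric]) simp
  then obtain U where U: "sum U (range v) = 1" "(\<Sum>w\<in>range v. U w *\<^sub>R w) = x"
    using affine_hull_finite[of "range v"] by fastforce
  define u where "u j = U (v j)" for j
  have u1: "sum u UNIV = 1" and x: "x = (\<Sum>j\<in>UNIV. u j *\<^sub>R v j)"
    using U by (simp_all add: sum.reindex[OF inj] u_def)
  have "A x $ j = u j * A (v j) $ j" for j
    unfolding x affine_map_sum[OF aff u1] by (simp add: row)
  with u1 x show ?thesis using that by blast
qed

text \<open>The \<open>n\<close> hyperplanes other than the \<open>k\<close>-th meet in dimension 0,
  that is, in one point. All \<open>n + 1\<close> have no common point, so this one misses the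
  \<open>k\<close>-th.\<close>

lemma generic_vertex:
  fixes A :: "real^'n \<Rightarrow> real^'m"
  assumes card: "CARD('m) = CARD('n) + 1" and gen: "generic A"
  obtains x where "\<And>j. j \<noteq> k \<Longrightarrow> A x $ j = 0" "A x $ k \<noteq> 0"
proof -
  have c: "card (- {k}) = CARD('n)" using card by (simp add: Compl_eq_Diff_UNIV card_Diff_singleton)
  then have "- {k} \<noteq> {}" by (intro notI) simp
  then have "aff_dim (\<Inter>j\<in>- {k}. hyperplane A j) = 0"
    using gen c unfolding generic_def by simp
  then obtain x where x: "(\<Inter>j\<in>- {k}. hyperplane A j) = {x}"
    using aff_dim_eq_0 by blast
  then have off: "A x $ j = 0" if "j \<noteq> k" for j
    using that by (auto simp: hyperplane_def)
  have "(\<Inter>j. hyperplane A j) = {}" using gen card unfolding generic_def by simp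
  then obtain j where "A x $ j \<noteq> 0" by (auto simp: hyperplane_def)
  then have "A x $ k \<noteq> 0" using off by metis
  with off that show ?thesis by blast
qed

section \<open>Sums of rectified affine functions\<close>

text \<open>Here \<open>c\<close> and \<open>g\<close> are the bias and the weights of the output
  layer. With both left arbitrary, the results below also apply to \<open>- F\<close>, whose bias
  and weights are negated.\<close>

context
  fixes A :: "real^'n \<Rightarrow> real^'m" and F :: "real^'n \<Rightarrow> real" and c :: real and g :: "'m \<Rightarrow> real"
  assumes aff: "affine_map A"
    and F: "F = (\<lambda>x. c + (\<Sum>j\<in>UNIV. g j * max 0 (A x $ j)))"
begin

lemma continuous_relu_sum: "continuous_on UNIV F"
proof -
  obtain L b where L: "linear L" and A: "A = (\<lambda>x. L x + b)"
    using aff unfolding affine_map_def by blast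
  have "continuous_on UNIV A"
    unfolding A using L by (intro continuous_intros linear_continuous_on) (simp add: linear_linear)
  then show ?thesis unfolding F by (intro continuous_intros)
qed

lemma convex_relu_sum:
  assumes g: "\<And>j. g j \<ge> 0"
  shows "convex_on UNIV F"
  unfolding convex_on_def
proof (intro conjI ballI allI impI)
  fix x y and a b :: real
  assume ab: "0 \<le> a" "0 \<le> b" "a + b = 1"
  have A: "A (a *\<^sub>R x + b *\<^sub>R y) = a *\<^sub>R A x + b *\<^sub>R A y"
    \<comment> \<open>The combination of two points is written as a sum indexed by the
      booleans.\<close>
    using affine_map_sum[OF aff, where I = "UNIV :: bool set"
        and u = "\<lambda>i. if i then a else b" and v = "\<lambda>i. if i then x else y"] ab
    by (simp add: UNIV_bool add.commute)
  have "max 0 (A (a *\<^sub>R x + b *\<^sub>R y) $ j) \<le> a * max 0 (A x $ j) + b * max 0 (A y $ j)" for j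
    using ab by (auto simp: A intro!: add_nonneg_nonneg add_mono mult_left_mono)
  then have "(\<Sum>j\<in>UNIV. g j * max 0 (A (a *\<^sub>R x + b *\<^sub>R y) $ j))
      \<le> (\<Sum>j\<in>UNIV. g j * (a * max 0 (A x $ j) + b * max 0 (A y $ j)))"
    using g by (intro sum_mono mult_left_mono) auto
  also have "\<dots> = a * (\<Sum>j\<in>UNIV. g j * max 0 (A x $ j)) + b * (\<Sum>j\<in>UNIV. g j * max 0 (A y $ j))"
    by (simp add: sum_distrib_left sum.distrib algebra_simps)
  finally have "F (a *\<^sub>R x + b *\<^sub>R y) \<le> (a + b) * c +
      (a * (\<Sum>j\<in>UNIV. g j * max 0 (A x $ j)) + b * (\<Sum>j\<in>UNIV. g j * max 0 (A y $ j)))"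
    using ab by (simp add: F)
  then show "F (a *\<^sub>R x + b *\<^sub>R y) \<le> a * F x + b * F y"
    by (simp add: F algebra_simps)
qed simp

context
  fixes v :: "'m \<Rightarrow> real^'n"
  assumes card: "CARD('m) = CARD('n) + 1"
    and off: "\<And>j k. j \<noteq> k \<Longrightarrow> A (v k) $ j = 0"
begin

text \<open>On the line through \<open>v k\<close> and \<open>v l\<close> only the terms
  \<open>k\<close> and \<open>l\<close> of \<open>F\<close> can be nonzero. A wrong sign or a zero
  weight makes both vanish on some edge of that line, where \<open>F\<close> would be constantly
  \<open>c\<close>.\<close>

lemma nonflat_imp_signs:
  assumes diag: "\<And>k. A (v k) $ k \<noteq> 0"
    and nonflat: "\<forall>C. flat_cell A F C \<longrightarrow> (\<exists>w\<in>vertices A. C = {w})"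
  shows "A (v k) $ k > 0" and "g k \<noteq> 0"
proof -
  have not_const: "\<not> F constant_on (\<Inter>j. S j)"
    if "\<forall>j. S j \<in> {hyperplane A j, {x. A x $ j \<ge> 0}, {x. A x $ j \<le> 0}}"
      and "x \<in> (\<Inter>j. S j)" "y \<in> (\<Inter>j. S j)" "x \<noteq> y" for S x y
  proof
    assume "F constant_on (\<Inter>j. S j)"
    moreover have "(\<Inter>j. S j) \<in> canonical_complex A"
      unfolding canonical_complex_def using that by blast
    ultimately obtain w where "(\<Inter>j. S j) = {w}"
      using nonflat unfolding flat_cell_def by blast
    then show False using that(2-4) by (metis singletonD)
  qed
  have constI: "F constant_on C" if "\<And>x. x \<in> C \<Longrightarrow> F x = c" for C
    unfolding constant_on_def by (intro exI[of _ c] ballI that)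
  have F_two: "F x = c + (g k * max 0 (A x $ k) + g l * max 0 (A x $ l))"
    if "k \<noteq> l" and "\<And>j. j \<noteq> k \<Longrightarrow> j \<noteq> l \<Longrightarrow> A x $ j = 0" for k l x
  proof -
    have "(\<Sum>j\<in>UNIV. g j * max 0 (A x $ j)) = (\<Sum>j\<in>{k, l}. g j * max 0 (A x $ j))"
      using that by (intro sum.mono_neutral_right) auto
    then show ?thesis using that by (simp add: F)
  qed
  have neq: "v k \<noteq> v l" if "k \<noteq> l" for k l
    using that off diag by metis
  have other: "\<exists>l. l \<noteq> k" for k :: 'm
  proof (rule ccontr)
    assume "\<nexists>l. l \<noteq> k"
    then have "(UNIV :: 'm set) = {k}" by auto
    then have "CARD('m) = 1" by (metis card_1_singleton_iff One_nat_def)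
    then show False using card by simp
  qed
  \<comment> \<open>The booleans select sides: \<open>S k l p q\<close> describes the part of the
    line through \<open>v k\<close> and \<open>v l\<close> on side \<open>p\<close> of hyperplane
    \<open>k\<close> and side \<open>q\<close> of hyperplane \<open>l\<close>.\<close>
  define H where "H b j = (if b then {x. A x $ j \<ge> 0} else {x. A x $ j \<le> 0})" for b j
  define S where "S k l p q j = (if j = k then H p k else if j = l then H q l else hyperplane A j)"
    for k l p q j
  have S_ok: "\<forall>j. S k l p q j \<in> {hyperplane A j, {x. A x $ j \<ge> 0}, {x. A x $ j \<le> 0}}" for k l p q
    unfolding S_def H_def by auto
  have mem: "x \<in> (\<Inter>j. S k l p q j) \<longleftrightarrow> x \<in> H p k \<and> x \<in> H q l \<and>
      (\<forall>j. j \<noteq> k \<longrightarrow> j \<noteq> l \<longrightarrow> A x $ j = 0)" if "k \<noteq> l" for k l p q x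
    using that by (auto simp: S_def hyperplane_def)

  \<comment> \<open>The ray from \<open>v k\<close> away from \<open>v l\<close> is an edge.\<close>
  have ray: "\<not> F constant_on (\<Inter>j. S k l (A (v k) $ k > 0) (A (v l) $ l < 0) j)"
    if kl: "k \<noteq> l" for k l
  proof (rule not_const[OF S_ok])
    \<comment> \<open>The reflection of \<open>v l\<close> in \<open>v k\<close> is a second point
      of the ray: its coordinate \<open>k\<close> under \<open>A\<close> is doubled and its
      coordinate \<open>l\<close> is negated.\<close>
    define y where "y = v k + (v k - v l)"
    obtain L b where L: "linear L" and A: "A = (\<lambda>x. L x + b)"
      using aff unfolding affine_map_def by blast
    have "A y = A (v k) + (A (v k) - A (v l))"
      unfolding y_def A linear_add[OF L] linear_diff[OF L] by simp
    then have y: "A y $ j = 2 * A (v k) $ j - A (v l) $ j" for j by simp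
    show "v k \<in> (\<Inter>j. S k l (A (v k) $ k > 0) (A (v l) $ l < 0) j)"
      unfolding mem[OF kl] using kl off by (auto simp: H_def)
    show "y \<in> (\<Inter>j. S k l (A (v k) $ k > 0) (A (v l) $ l < 0) j)"
      unfolding mem[OF kl] using kl off by (auto simp: H_def y)
    show "v k \<noteq> y"
      using neq[OF kl] by (simp add: y_def)
  qed
  \<comment> \<open>On the ray beyond \<open>v k\<close>, coordinate \<open>k\<close> keeps the
    negative sign it has at \<open>v k\<close> and coordinate \<open>l\<close> is opposite to its
    sign at \<open>v l\<close>, so neither is positive.\<close>
  have no_mix: "\<not> (A (v k) $ k < 0 \<and> A (v l) $ l > 0)" if kl: "k \<noteq> l" for k l
  proof
    assume *: "A (v k) $ k < 0 \<and> A (v l) $ l > 0"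
    have "F x = c" if "x \<in> (\<Inter>j. S k l (A (v k) $ k > 0) (A (v l) $ l < 0) j)" for x
      using that * F_two[OF kl, of x] unfolding mem[OF kl] by (auto simp: H_def max_def)
    then show False using ray[OF kl] constI by meson
  qed
  \<comment> \<open>Here the flat edge would be the segment between \<open>v k\<close> and
    \<open>v l\<close>, on which both coordinates are nonpositive.\<close>
  have no_neg: "\<not> (A (v k) $ k < 0 \<and> A (v l) $ l < 0)" if kl: "k \<noteq> l" for k l
  proof
    assume *: "A (v k) $ k < 0 \<and> A (v l) $ l < 0"
    have "F x = c" if "x \<in> (\<Inter>j. S k l False False j)" for x
      using that F_two[OF kl, of x] unfolding mem[OF kl] by (auto simp: H_def max_def)
    then have "F constant_on (\<Inter>j. S k l False False j)" by (rule constI)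
    moreover have "v k \<in> (\<Inter>j. S k l False False j)" "v l \<in> (\<Inter>j. S k l False False j)"
      unfolding mem[OF kl] using kl off * by (auto simp: H_def)
    ultimately show False using not_const[OF S_ok _ _ neq[OF kl]] by meson
  qed
  show pos: "A (v k) $ k > 0" for k
    using other[of k] no_mix no_neg diag by (metis linorder_neqE_linordered_idom)
  show "g k \<noteq> 0"
  proof
    assume g: "g k = 0"
    obtain l where l: "l \<noteq> k" using other by blast
    have kl: "k \<noteq> l" using l by simp
    \<comment> \<open>On the ray beyond \<open>v k\<close> the weight kills term \<open>k\<close>,
      and coordinate \<open>l\<close> is nonpositive because it is positive at
      \<open>v l\<close>.\<close>
    have "F x = c" if "x \<in> (\<Inter>j. S k l (A (v k) $ k > 0) (A (v l) $ l < 0) j)" for x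
      using that g F_two[OF kl, of x] pos[of l] unfolding mem[OF kl]
      by (auto simp: H_def max_def split: if_splits)
    then show False using ray[OF kl] constI by meson
  qed
qed

text \<open>All terms are nonnegative, so \<open>F x \<le> 0\<close> bounds each of them by
  \<open>\<bar>c\<bar>\<close>. This bounds the barycentric coordinates from above, and since they
  sum to 1 also from below.\<close>

lemma bounded_sublevel_relu_sum:
  assumes pos: "\<And>j. A (v j) $ j > 0" and g: "\<And>j. g j > 0"
  shows "bounded {x. F x \<le> 0}"
proof -
  have diag: "A (v k) $ k \<noteq> 0" for k using pos[of k] by simp
  define M where "M j = \<bar>c\<bar> / (g j * A (v j) $ j)" for j
  \<comment> \<open>The summand 1 covers the lower bound \<open>1 - (\<Sum>j\<in>UNIV. M j)\<close>
    for the coordinates.\<close>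
  define B where "B = (\<Sum>j\<in>UNIV. M j) + 1"
  have M0: "M j \<ge> 0" for j
    using pos[of j] g[of j] by (simp add: M_def)
  have "norm x \<le> (\<Sum>j\<in>UNIV. B * norm (v j))" if x: "F x \<le> 0" for x
  proof -
    obtain u where u: "sum u UNIV = 1" "x = (\<Sum>j\<in>UNIV. u j *\<^sub>R v j)"
        "\<And>j. A x $ j = u j * A (v j) $ j"
      using barycentric_coordinates[OF card aff off diag, of x] by blast
    have upper: "u k \<le> M k" for k
    proof -
      have "g k * max 0 (A x $ k) \<le> (\<Sum>j\<in>UNIV. g j * max 0 (A x $ j))"
        using g by (intro member_le_sum mult_nonneg_nonneg) (auto simp: less_imp_le)
      also have "\<dots> \<le> \<bar>c\<bar>" using x by (simp add: F)
      finally have "g k * max 0 (A x $ k) \<le> \<bar>c\<bar>" .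
      moreover have "g k * A x $ k \<le> g k * max 0 (A x $ k)" using g[of k] by simp
      ultimately have "u k * (g k * A (v k) $ k) \<le> \<bar>c\<bar>" using u(3)[of k] by (simp add: ac_simps)
      then show ?thesis using pos[of k] g[of k] by (simp add: M_def pos_le_divide_eq)
    qed
    have abs: "\<bar>u k\<bar> \<le> B" for k
    proof -
      have "1 = u k + (\<Sum>j\<in>UNIV - {k}. u j)" using u(1) by (simp add: sum.remove[of _ k])
      also have "(\<Sum>j\<in>UNIV - {k}. u j) \<le> (\<Sum>j\<in>UNIV - {k}. M j)" using upper by (intro sum_mono)
      also have "\<dots> \<le> (\<Sum>j\<in>UNIV. M j)" using M0 by (intro sum_mono2) auto
      finally have "u k \<ge> 1 - (\<Sum>j\<in>UNIV. M j)" by simp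
      moreover have "M k \<le> (\<Sum>j\<in>UNIV. M j)" using M0 by (intro member_le_sum) auto
      moreover have "u k \<le> M k" by (rule upper)
      ultimately show ?thesis unfolding B_def by linarith
    qed
    have "norm x \<le> (\<Sum>j\<in>UNIV. norm (u j *\<^sub>R v j))" unfolding u(2) by (rule norm_sum)
    also have "\<dots> \<le> (\<Sum>j\<in>UNIV. B * norm (v j))"
      using abs by (intro sum_mono) (simp add: mult_right_mono)
    finally show ?thesis .
  qed
  then show ?thesis unfolding bounded_iff by blast
qed

text \<open>Along a direction in which every coordinate \<open>j\<close> of \<open>A\<close> changes
  with the sign of \<open>g j\<close>, no term of \<open>F\<close> decreases and every active term
  strictly increases.\<close>

lemma contractible_level_relu_sum:
  assumes pos: "\<And>j. A (v j) $ j > 0" and g: "\<And>j. g j \<noteq> 0"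
    and p: "g p > 0" and q: "g q < 0"
  shows "F -` {0} \<noteq> {}" and "contractible (F -` {0})"
proof -
  have diag: "A (v k) $ k \<noteq> 0" for k using pos[of k] by simp
  define P where "P = {j. g j > 0}"
  have P: "p \<in> P" "q \<in> - P" using p q by (auto simp: P_def)
  \<comment> \<open>The resulting \<open>d\<close> leads from the barycenter of the vertices with
    negative weight to that of the vertices with positive weight. Both groups are nonempty, and the
    coefficients sum to 0, as a displacement in barycentric coordinates requires.\<close>
  define al where "al j = (if g j > 0 then 1 / card P else - 1 / card (- P))" for j
  have cardP: "card P > 0" "card (- P) > 0" using P by (auto simp: card_gt_0_iff)
  have al_sign: "g j * al j > 0" for j
    using g[of j] cardP by (cases "g j > 0") (auto simp: al_def divide_simps)
  have al0: "sum al UNIV = 0"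
  proof -
    have "sum al UNIV = sum al P + sum al (- P)"
      by (metis Compl_partition Compl_disjoint finite sum.union_disjoint)
    also have "sum al P = (\<Sum>j\<in>P. 1 / card P)" by (intro sum.cong) (auto simp: al_def P_def)
    also have "sum al (- P) = (\<Sum>j\<in>- P. - 1 / card (- P))"
      by (intro sum.cong) (auto simp: al_def P_def)
    finally show ?thesis using P by auto
  qed
  define d where "d = (\<Sum>j\<in>UNIV. al j *\<^sub>R v j)"
  define be where "be j = al j * A (v j) $ j" for j
  have be_sign: "g j * be j > 0" for j
    using mult_pos_pos[OF al_sign[of j] pos[of j]] by (simp add: be_def mult.assoc)
  have coord: "\<exists>u. sum u UNIV = 1 \<and> x = (\<Sum>j\<in>UNIV. u j *\<^sub>R v j) \<and> (\<forall>j. A x $ j = u j * A (v j) $ j)" for x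
    using barycentric_coordinates[OF card aff off diag, of x] by blast
  have line: "A (x + s *\<^sub>R d) $ j = A x $ j + s * be j" for x s j
  proof -
    obtain u where u: "sum u UNIV = 1" "x = (\<Sum>j\<in>UNIV. u j *\<^sub>R v j)"
      using coord by blast
    have w: "(\<Sum>j\<in>UNIV. u j + s * al j) = 1"
      by (simp add: sum.distrib u al0 flip: sum_distrib_left)
    have "x + s *\<^sub>R d = (\<Sum>j\<in>UNIV. (u j + s * al j) *\<^sub>R v j)"
      by (simp add: u(2) d_def scaleR_add_left sum.distrib scaleR_sum_right)
    then have "A (x + s *\<^sub>R d) = (\<Sum>i\<in>UNIV. (u i + s * al i) *\<^sub>R A (v i))"
      using affine_map_sum[OF aff w] by simp
    also have "\<dots> = A x + s *\<^sub>R (\<Sum>i\<in>UNIV. al i *\<^sub>R A (v i))"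
      using affine_map_sum[OF aff u(1), of v] u(2)
      by (simp add: scaleR_add_left sum.distrib scaleR_sum_right)
    finally have "A (x + s *\<^sub>R d) $ j = A x $ j + s * (\<Sum>i\<in>UNIV. al i * A (v i) $ j)"
      by simp
    also have "(\<Sum>i\<in>UNIV. al i * A (v i) $ j) = (\<Sum>i\<in>UNIV. if i = j then be j else 0)"
      using off by (intro sum.cong) (auto simp: be_def)
    finally show ?thesis by simp
  qed
  \<comment> \<open>Barycentric coordinates sum to 1, so they cannot all be nonpositive: at every
    point some term is active, which makes the monotonicity strict.\<close>
  have some_pos: "\<exists>j. A x $ j > 0" for x
  proof (rule ccontr)
    assume "\<nexists>j. A x $ j > 0"
    moreover obtain u where u: "sum u UNIV = 1" "\<And>j. A x $ j = u j * A (v j) $ j"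
      using coord by blast
    ultimately have "u j \<le> 0" for j
      using pos[of j] by (metis mult_pos_pos not_le)
    then have "sum u UNIV \<le> 0" by (intro sum_nonpos)
    then show False using u by simp
  qed
  have term_mono: "g j * max 0 (y + s * be j) \<le> g j * max 0 (y + t * be j)"
    if "s \<le> t" for j y s t
  proof (cases "g j > 0")
    case True
    then have "be j > 0" using be_sign[of j] by (simp add: zero_less_mult_iff)
    then have "s * be j \<le> t * be j" using that by simp
    then have "max 0 (y + s * be j) \<le> max 0 (y + t * be j)" by (simp add: max_def)
    then show ?thesis using True by simp
  next
    case False
    then have g': "g j < 0" "be j < 0" using be_sign[of j] g[of j] by (auto simp: zero_less_mult_iff)
    then have "t * be j \<le> s * be j" using that by simp
    then have "max 0 (y + t * be j) \<le> max 0 (y + s * be j)" by (simp add: max_def)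
    then show ?thesis using g' by simp
  qed
  have term_strict: "g j * max 0 (y + s * be j) < g j * max 0 (y + t * be j)"
    if "s < t" "y + s * be j > 0" for j y s t
  proof (cases "g j > 0")
    case True
    then have "be j > 0" using be_sign[of j] by (simp add: zero_less_mult_iff)
    then have "s * be j < t * be j" using that by simp
    then have "max 0 (y + s * be j) < max 0 (y + t * be j)" using that by (simp add: max_def)
    then show ?thesis using True by simp
  next
    case False
    then have g': "g j < 0" "be j < 0" using be_sign[of j] g[of j] by (auto simp: zero_less_mult_iff)
    then have "t * be j < s * be j" using that by simp
    then have "max 0 (y + t * be j) < max 0 (y + s * be j)" using that by (simp add: max_def)
    then show ?thesis using g' by simp
  qed
  have mono: "strict_mono (\<lambda>s. F (x + s *\<^sub>R d))" for x
  proof (rule strict_monoI)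
    fix s t :: real assume st: "s < t"
    obtain j where j: "A x $ j + s * be j > 0" using some_pos[of "x + s *\<^sub>R d"] line by auto
    have "(\<Sum>i\<in>UNIV. g i * max 0 (A x $ i + s * be i)) < (\<Sum>i\<in>UNIV. g i * max 0 (A x $ i + t * be i))"
      using term_mono[of s t] term_strict[OF st j] st by (intro sum_strict_mono_ex1) auto
    then show "F (x + s *\<^sub>R d) < F (x + t *\<^sub>R d)"
      by (simp add: F line)
  qed
  \<comment> \<open>No term decreases along \<open>d\<close>, so the growth of \<open>F\<close> is
    at least that of any single term.\<close>
  have F_diff: "g j * max 0 (A x $ j + t * be j) - g j * max 0 (A x $ j + s * be j)
      \<le> F (x + t *\<^sub>R d) - F (x + s *\<^sub>R d)" if "s \<le> t" for j x s t
  proof -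
    have "F (x + t *\<^sub>R d) - F (x + s *\<^sub>R d) =
        (\<Sum>i\<in>UNIV. g i * max 0 (A x $ i + t * be i) - g i * max 0 (A x $ i + s * be i))"
      by (simp add: F line sum_subtractf)
    also have "\<dots> \<ge> g j * max 0 (A x $ j + t * be j) - g j * max 0 (A x $ j + s * be j)"
      using term_mono[OF that]
      by (intro member_le_sum[where f = "\<lambda>i. g i * max 0 (A x $ i + t * be i) - g i * max 0 (A x $ i + s * be i)"])
        auto
    finally show ?thesis .
  qed
  have root: "\<exists>s. F (x + s *\<^sub>R d) = 0" for x
  proof -
    have expand: "g j * (A x $ j + s * be j) = g j * A x $ j + s * (g j * be j)" for j s
      by (simp add: algebra_simps)
    \<comment> \<open>Replacing the rectified value by the affine one bounds term \<open>p\<close>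
      below by a function of slope \<open>g p * be p\<close>; this \<open>t\<close> is large enough
      for its growth to outweigh \<open>\<bar>F x\<bar>\<close>.\<close>
    define t where "t = (\<bar>F x\<bar> + \<bar>g p * max 0 (A x $ p)\<bar> + \<bar>g p * A x $ p\<bar>) / (g p * be p)"
    have t0: "t \<ge> 0" using be_sign[of p] by (simp add: t_def)
    have "g p * (A x $ p + t * be p) \<le> g p * max 0 (A x $ p + t * be p)" using p by simp
    moreover have "t * (g p * be p) = \<bar>F x\<bar> + \<bar>g p * max 0 (A x $ p)\<bar> + \<bar>g p * A x $ p\<bar>"
      using be_sign[of p] unfolding t_def by (metis less_irrefl nonzero_divide_eq_eq)
    ultimately have hi: "F (x + t *\<^sub>R d) \<ge> 0"
      using F_diff[OF t0, of p x, simplified] expand[of p t] by linarith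
    \<comment> \<open>Backwards along \<open>d\<close>, term \<open>q\<close> tends to minus
      infinity in the same way: \<open>be q\<close> and \<open>g q\<close> are both
      negative.\<close>
    define s where "s = - ((\<bar>F x\<bar> + \<bar>g q * max 0 (A x $ q)\<bar> + \<bar>g q * A x $ q\<bar>) / (g q * be q))"
    have s0: "s \<le> 0" using be_sign[of q] by (simp add: s_def)
    have "g q * max 0 (A x $ q + s * be q) \<le> g q * (A x $ q + s * be q)" using q by simp
    moreover have "s * (g q * be q) = - (\<bar>F x\<bar> + \<bar>g q * max 0 (A x $ q)\<bar> + \<bar>g q * A x $ q\<bar>)"
      using be_sign[of q] unfolding s_def by (metis less_irrefl nonzero_divide_eq_eq mult_minus_left)
    ultimately have lo: "F (x + s *\<^sub>R d) \<le> 0"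
      using F_diff[OF s0, of q x, simplified] expand[of q s] by linarith
    have "continuous_on {s..t} (\<lambda>s. F (x + s *\<^sub>R d))"
      by (rule continuous_on_compose2[OF continuous_relu_sum]) (auto intro!: continuous_intros)
    then show ?thesis using IVT'[of "\<lambda>s. F (x + s *\<^sub>R d)" s 0 t] lo hi s0 t0 by force
  qed
  show "F -` {0} \<noteq> {}" "contractible (F -` {0})"
    using contractible_level_set_of_increasing[OF continuous_relu_sum mono root] by auto
qed

end

end

section \<open>Case distinction on the signs of the output weights\<close>

theorem theorem2:
  fixes A :: "real^'n \<Rightarrow> real^'m" and G :: "real^'m \<Rightarrow> real" and F :: "real^'n \<Rightarrow> real"
  assumes "CARD('m) = CARD('n) + 1"
    and "affine_map A" and "affine_map G"
    and "F = G \<circ> relu \<circ> A"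
    and "generic A"
    and "PL_Morse A F"
    and "\<forall>C. flat_cell A F C \<longrightarrow> (\<exists>v\<in>vertices A. C = {v})"
  shows "F -` {0} = {} \<or>
         F -` {0} homotopy_eqv {0 :: real^'n} \<or>
         F -` {0} homotopy_eqv sphere (0 :: real^'n) 1"
proof -
  have "\<forall>k. \<exists>x. (\<forall>j. j \<noteq> k \<longrightarrow> A x $ j = 0) \<and> A x $ k \<noteq> 0"
    using generic_vertex[OF assms(1,5)] by metis
  then obtain v where off: "\<And>j k. j \<noteq> k \<Longrightarrow> A (v k) $ j = 0" and diag: "\<And>k. A (v k) $ k \<noteq> 0"
    by metis
  obtain c g where G: "\<And>y. G y = c + (\<Sum>j\<in>UNIV. g j * y $ j)"
    using affine_map_vec_eq[OF assms(3)] by blast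
  have F: "F = (\<lambda>x. c + (\<Sum>j\<in>UNIV. g j * max 0 (A x $ j)))"
    by (simp add: assms(4) G relu_def fun_eq_iff)
  have pos: "A (v k) $ k > 0" and g: "g k \<noteq> 0" for k
    using nonflat_imp_signs[OF assms(2) F assms(1) off diag assms(7)] by auto
  consider "\<forall>j. g j > 0" | "\<forall>j. g j < 0" | p q where "g p > 0" "g q < 0"
    using g by (meson linorder_neqE_linordered_idom)
  then show ?thesis
  proof cases
    case 1
    then show ?thesis
      using continuous_relu_sum[OF assms(2) F] convex_relu_sum[OF assms(2) F]
        bounded_sublevel_relu_sum[OF assms(2) F assms(1) off pos]
      by (intro level_set_of_convex) (auto intro: less_imp_le)
  next
    case 2
    \<comment> \<open>Negation preserves the zero set and makes all weights positive, which gives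
      the convex case for \<open>- F\<close>.\<close>
    have F': "(\<lambda>x. - F x) = (\<lambda>x. - c + (\<Sum>j\<in>UNIV. - g j * max 0 (A x $ j)))"
      by (simp add: F sum_negf)
    have "(\<lambda>x. - F x) -` {0} = F -` {0}" by auto
    then show ?thesis
      using 2 level_set_of_convex[of "\<lambda>x. - F x"] continuous_relu_sum[OF assms(2) F']
        convex_relu_sum[OF assms(2) F'] bounded_sublevel_relu_sum[OF assms(2) F' assms(1) off pos]
      by (simp add: less_imp_le)
  next
    case 3
    then show ?thesis
      using contractible_level_relu_sum[OF assms(2) F assms(1) off pos g] homotopy_eqv_sing by blast
  qed
qed

end
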